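(* Let $H$ be a finite-dimensional real Hilbert space and let $f:H\to\mathbb{R}$ be twice continuously differentiable and bounded below, with nonempty set of minimizers. Assume that for some $L_\nu>0$ and $\nu\in[0,1]$ one has $\|\nabla^2 f(x)-\nabla^2 f(y)\|\le L_\nu\|x-y\|^\nu$ for all $x,y\in H$. Let $(x_k)_k$ be generated by the exact UniCAT trust-region method (described in the context) with parameter $\vartheta>0$. Let $x_\star$ be a local minimizer of $f$, and suppose that $\nabla^2 f(x_\star)\succ0$ and $x_k\to x_\star$. Moreover assume $\eta_2<\frac{1}{1+\vartheta/2}$. Then there exist an index $K_0\in\mathbb{N}$ and a lower bound $\underline\Delta>0$ such that: (i) for all $k\ge K_0$ the step is very successful, i.e. $\rho_k^\vartheta\ge\eta_2$; (ii) for all $k\ge K_0$, $\Delta_k\ge\underline\Delta$; (iii) for all $k\ge K_0$ the trust-region constraint is inactive in the sense that $\|s_k\|<\Delta_k$, and $s_k=-\nabla^2 f(x_k)^{-1}\nabla f(x_k)$, the classical Newton step; (iv) if $\nu=0$, the method eventually converges Q-superlinearly, i.e. $\|x_{k+1}-x_\star\|=o(\|x_k-x_\star\|)$; (v) if $\nu\in(0,1]$, then there exists a constant $C>0$ such that, for all sufficiently large $k$, $\|x_{k+1}-x_\star\|\le C\|x_k-x_\star\|^{1+\nu}$.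
   Context: $\mathbb{N}=\{0,1,2,\dots\}$. Write $g_k:=\nabla f(x_k)$, $H_k:=\nabla^2 f(x_k)$ and $m_k(s):=f(x_k)+\langle g_k,s\rangle+\tfrac12\langle H_ks,s\rangle$. Exact UniCAT method. Inputs: $x_0\in H$, $\Delta_0>0$, $\vartheta>0$, constants $0<\eta_1\le\eta_2<1$, $0<\gamma_1\le\gamma_2<1\le\gamma_3$. For $k=0,1,2,\dots$: if $\|g_k\|=0$, terminate and return $x_k$. Otherwise take an exact solution $s_k\in\arg\min_{\|s\|\le\Delta_k}m_k(s)$ and set $$\rho_k^\vartheta:=\frac{f(x_k)-f(x_k+s_k)}{m_k(0)-m_k(s_k)+\frac{\vartheta}{2}\min\{\|\nabla f(x_k)\|,\|\nabla f(x_k+s_k)\|\}\|s_k\|}.$$ Set $x_{k+1}=x_k+s_k$ if $\rho_k^\vartheta\ge\eta_1$ and $x_{k+1}=x_k$ otherwise. Choose $\Delta_{k+1}$ arbitrarily in $[\gamma_1\Delta_k,\gamma_2\Delta_k]$ if $\rho_k^\vartheta<\eta_1$, in $[\gamma_2\Delta_k,\Delta_k]$ if $\eta_1\le\rho_k^\vartheta<\eta_2$, and in $[\Delta_k,\gamma_3\Delta_k]$ if $\rho_k^\vartheta\ge\eta_2$. Standing convention: the method does not terminate finitely, i.e. $\|\nabla f(x_k)\|>0$ and $f(x_k)-\min f>0$ for all $k\in\mathbb{N}$. *)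

theory Defs
  imports "HOL-Analysis.Analysis" "HOL-Library.Landau_Symbols"
begin

definition gradient :: "('a::euclidean_space \<Rightarrow> real) \<Rightarrow> 'a \<Rightarrow> 'a" where
  "gradient f x = (THE g. GDERIV f x :> g)"

text \<open>The Hessian is the derivative of the gradient, as a bounded operator; its norm is thus the
  operator norm induced by the norm of the space.\<close>

definition hessian :: "('a::euclidean_space \<Rightarrow> real) \<Rightarrow> 'a \<Rightarrow> 'a \<Rightarrow>\<^sub>L 'a" where
  "hessian f x = Blinfun (frechet_derivative (gradient f) (at x))"

definition twice_continuously_differentiable :: "('a::euclidean_space \<Rightarrow> real) \<Rightarrow> bool" where
  "twice_continuously_differentiable f \<longleftrightarrow>
     (\<forall>x. f differentiable (at x)) \<and>
     (\<forall>x. gradient f differentiable (at x)) \<and>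
     continuous_on UNIV (hessian f)"

lemma gradient_eqI:
  assumes "GDERIV f x :> g"
  shows "gradient f x = g"
  unfolding gradient_def
proof (rule the_equality)
  fix g' assume "GDERIV f x :> g'"
  then have "(\<lambda>h. h \<bullet> g') = (\<lambda>h. h \<bullet> g)"
    using assms unfolding gderiv_def by (rule has_derivative_unique)
  then have "\<forall>h. h \<bullet> g' = h \<bullet> g"
    by (simp add: fun_eq_iff)
  then show "g' = g"
    by (simp only: vector_eq_ldot)
qed (fact assms)

lemma GDERIV_gradient:
  assumes "f differentiable (at x)"
  shows "GDERIV f x :> gradient f x"
proof -
  obtain D where D: "(f has_derivative D) (at x)"
    using assms unfolding differentiable_def by blast
  have "(\<lambda>h. h \<bullet> adjoint D 1) = D"
    by (simp add: fun_eq_iff adjoint_works[OF has_derivative_linear[OF D]])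
  then have "GDERIV f x :> adjoint D 1"
    unfolding gderiv_def using D by simp
  then show ?thesis
    by (simp only: gradient_eqI)
qed

lemma has_derivative_hessian:
  assumes "gradient f differentiable (at x)"
  shows "(gradient f has_derivative blinfun_apply (hessian f x)) (at x)"
proof -
  have *: "(gradient f has_derivative frechet_derivative (gradient f) (at x)) (at x)"
    using assms by (simp add: frechet_derivative_works)
  then show ?thesis
    by (simp add: hessian_def bounded_linear_Blinfun_apply[OF has_derivative_bounded_linear[OF *]])
qed

text \<open>No symmetry clause: the operators of interest are Hessians of twice continuously
  differentiable functions, which are self-adjoint.\<close>

definition positive_definite :: "('a::real_inner \<Rightarrow>\<^sub>L 'a) \<Rightarrow> bool" where
  "positive_definite A \<longleftrightarrow> (\<forall>v. v \<noteq> 0 \<longrightarrow> 0 < A v \<bullet> v)"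

definition local_minimizer :: "('a::metric_space \<Rightarrow> real) \<Rightarrow> 'a \<Rightarrow> bool" where
  "local_minimizer f z \<longleftrightarrow> (\<exists>\<epsilon>>0. \<forall>y\<in>ball z \<epsilon>. f z \<le> f y)"

definition quadratic_model :: "('a::euclidean_space \<Rightarrow> real) \<Rightarrow> 'a \<Rightarrow> 'a \<Rightarrow> real" where
  "quadratic_model f x s = f x + gradient f x \<bullet> s + 1/2 * (hessian f x s \<bullet> s)"

definition unicat_ratio ::
  "('a::euclidean_space \<Rightarrow> real) \<Rightarrow> real \<Rightarrow> 'a \<Rightarrow> 'a \<Rightarrow> real" where
  "unicat_ratio f \<theta> x s =
     (f x - f (x + s)) /
     (quadratic_model f x 0 - quadratic_model f x s
        + \<theta> / 2 * min (norm (gradient f x)) (norm (gradient f (x + s))) * norm s)"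

text \<open>One iteration from iterate \<open>x\<close> and radius \<open>\<Delta>\<close>, with trial step \<open>s\<close>, to iterate \<open>x'\<close> and
  radius \<open>\<Delta>'\<close>. It is a relation because neither the subproblem solution nor the new radius is
  determined. No iteration is possible from a point with vanishing gradient, so infinite
  runs are exactly those that never terminate.\<close>

definition unicat_step ::
  "('a::euclidean_space \<Rightarrow> real) \<Rightarrow> real \<Rightarrow> real \<Rightarrow> real \<Rightarrow> real \<Rightarrow> real \<Rightarrow> real \<Rightarrow>
   'a \<Rightarrow> real \<Rightarrow> 'a \<Rightarrow> 'a \<Rightarrow> real \<Rightarrow> bool" where
  "unicat_step f \<theta> \<eta>1 \<eta>2 \<gamma>1 \<gamma>2 \<gamma>3 x \<Delta> s x' \<Delta>' \<longleftrightarrow>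
     norm (gradient f x) \<noteq> 0 \<and>
     is_arg_min (quadratic_model f x) (\<lambda>u. norm u \<le> \<Delta>) s \<and>
     x' = (if unicat_ratio f \<theta> x s \<ge> \<eta>1 then x + s else x) \<and>
     \<Delta>' \<in> (if unicat_ratio f \<theta> x s < \<eta>1 then {\<gamma>1 * \<Delta> .. \<gamma>2 * \<Delta>}
           else if unicat_ratio f \<theta> x s < \<eta>2 then {\<gamma>2 * \<Delta> .. \<Delta>}
           else {\<Delta> .. \<gamma>3 * \<Delta>})"

definition unicat_run ::
  "('a::euclidean_space \<Rightarrow> real) \<Rightarrow> real \<Rightarrow> real \<Rightarrow> real \<Rightarrow> real \<Rightarrow> real \<Rightarrow> real \<Rightarrow>
   (nat \<Rightarrow> 'a) \<Rightarrow> (nat \<Rightarrow> real) \<Rightarrow> (nat \<Rightarrow> 'a) \<Rightarrow> bool" where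
  "unicat_run f \<theta> \<eta>1 \<eta>2 \<gamma>1 \<gamma>2 \<gamma>3 x \<Delta> s \<longleftrightarrow>
     0 < \<Delta> 0 \<and>
     (\<forall>k. unicat_step f \<theta> \<eta>1 \<eta>2 \<gamma>1 \<gamma>2 \<gamma>3 (x k) (\<Delta> k) (s k) (x (Suc k)) (\<Delta> (Suc k)))"

end

theory Submission
  imports Defs
begin

text \<open>Near \<open>xstar\<close> the Hessian is coercive with some constant \<open>\<mu>\<close>, so the trial steps tend to \<open>0\<close>.
  Let \<open>G\<close> be the gradient of the model at a trial step \<open>s\<close> and \<open>p\<close> the predicted decrease. Optimality
  of \<open>s\<close> gives \<open>\<parallel>G\<parallel> \<parallel>s\<parallel> \<le> p\<close> whether or not the constraint is active, and \<open>\<mu>/2 \<parallel>s\<parallel>\<^sup>2 \<le> p\<close>. The gradient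
  of \<open>f\<close> at the trial point is \<open>G + o(\<parallel>s\<parallel>)\<close>, hence the denominator of the ratio is at most
  \<open>(1 + \<theta>/2 + o(1)) p\<close>, while the numerator is \<open>(1 + o(1)) p\<close>. So eventually all steps are very
  successful and the radii stop shrinking; the constraint becomes inactive, \<open>G = 0\<close> is the
  Newton equation, and the classical local estimate for Newton's method applies.\<close>

section \<open>Derivatives along lines and symmetry of the Hessian\<close>

lemma twice_continuously_differentiableD:
  assumes "twice_continuously_differentiable f"
  shows "GDERIV f x :> gradient f x"
    and "(gradient f has_derivative blinfun_apply (hessian f x)) (at x)"
    and "isCont (hessian f) x"
  using assms unfolding twice_continuously_differentiable_def
  by (auto simp: continuous_on_eq_continuous_at intro: GDERIV_gradient has_derivative_hessian)

lemma DERIV_along_line: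
  assumes "twice_continuously_differentiable f"
  shows "((\<lambda>t. f (y + t *\<^sub>R u)) has_real_derivative gradient f (y + t *\<^sub>R u) \<bullet> u) (at t)"
proof -
  have "(f has_derivative (\<lambda>h. h \<bullet> gradient f (y + t *\<^sub>R u))) (at (y + t *\<^sub>R u))"
    using twice_continuously_differentiableD(1)[OF assms] by (simp add: gderiv_def)
  moreover have "((\<lambda>t. y + t *\<^sub>R u) has_derivative (\<lambda>h. h *\<^sub>R u)) (at t)"
    by (auto intro!: derivative_eq_intros)
  ultimately have "((\<lambda>t. f (y + t *\<^sub>R u)) has_derivative
      (\<lambda>h. (h *\<^sub>R u) \<bullet> gradient f (y + t *\<^sub>R u))) (at t)"
    by (rule has_derivative_compose[rotated])
  then show ?thesis
    by (simp add: has_field_derivative_def inner_commute mult_commute_abs)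
qed

lemma DERIV_gradient_along_line:
  assumes "twice_continuously_differentiable f"
  shows "((\<lambda>t. gradient f (y + t *\<^sub>R u) \<bullet> w) has_real_derivative
    hessian f (y + t *\<^sub>R u) u \<bullet> w) (at t)"
proof -
  have "((\<lambda>t. y + t *\<^sub>R u) has_derivative (\<lambda>h. h *\<^sub>R u)) (at t)"
    by (auto intro!: derivative_eq_intros)
  from has_derivative_compose[OF this twice_continuously_differentiableD(2)[OF assms]]
  have "((\<lambda>t. gradient f (y + t *\<^sub>R u) \<bullet> w) has_derivative
      (\<lambda>h. hessian f (y + t *\<^sub>R u) (h *\<^sub>R u) \<bullet> w)) (at t)"
    by (rule has_derivative_inner_left)
  then show ?thesis
    by (simp add: has_field_derivative_def blinfun.scaleR_right mult_commute_abs)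
qed

text \<open>The mean value theorem applies twice: in direction \<open>u\<close> to the increment
  along \<open>v\<close>, then in direction \<open>v\<close> to the resulting directional
  derivative. The left side is symmetric in \<open>u\<close> and \<open>v\<close>, which is what
  yields the symmetry of the Hessian.\<close>

lemma second_difference:
  assumes "twice_continuously_differentiable f"
  shows "\<exists>t\<in>{0<..<1}. \<exists>\<tau>\<in>{0<..<1}. f (x + u + v) - f (x + u) - f (x + v) + f x
    = hessian f (x + t *\<^sub>R u + \<tau> *\<^sub>R v) v \<bullet> u"
proof -
  let ?\<phi> = "\<lambda>t. f (x + v + t *\<^sub>R u) - f (x + t *\<^sub>R u)"
  let ?\<phi>' = "\<lambda>t. gradient f (x + v + t *\<^sub>R u) \<bullet> u - gradient f (x + t *\<^sub>R u) \<bullet> u"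
  have "(?\<phi> has_real_derivative ?\<phi>' t) (at t)" for t
    by (intro DERIV_diff DERIV_along_line assms)
  then obtain t where t: "0 < t" "t < 1" "?\<phi> 1 - ?\<phi> 0 = (1 - 0) * ?\<phi>' t"
    using MVT2[of 0 1 ?\<phi> ?\<phi>'] by auto
  let ?\<psi> = "\<lambda>\<tau>. gradient f (x + t *\<^sub>R u + \<tau> *\<^sub>R v) \<bullet> u"
  obtain \<tau> where \<tau>: "0 < \<tau>" "\<tau> < 1"
    "?\<psi> 1 - ?\<psi> 0 = (1 - 0) * (hessian f (x + t *\<^sub>R u + \<tau> *\<^sub>R v) v \<bullet> u)"
    using MVT2[of 0 1 ?\<psi> "\<lambda>\<tau>. hessian f (x + t *\<^sub>R u + \<tau> *\<^sub>R v) v \<bullet> u"]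
      DERIV_gradient_along_line[OF assms] by auto
  have "?\<phi> 1 - ?\<phi> 0 = ?\<psi> 1 - ?\<psi> 0"
    using t(3) by (simp add: algebra_simps)
  then show ?thesis
    using t(1,2) \<tau> by (intro bexI[of _ t] bexI[of _ \<tau>]) (auto simp: algebra_simps)
qed

text \<open>The second difference along \<open>e u\<close> and \<open>e v\<close>, divided by \<open>e\<^sup>2\<close>, tends to both sides as \<open>e\<close>
  tends to \<open>0\<close>.\<close>

lemma hessian_symmetric:
  assumes C2: "twice_continuously_differentiable f"
  shows "hessian f x u \<bullet> v = hessian f x v \<bullet> u"
proof -
  have "\<exists>y z. norm (y - x) \<le> e * (norm u + norm v) \<and> norm (z - x) \<le> e * (norm u + norm v) \<and>
      hessian f y v \<bullet> u = hessian f z u \<bullet> v" if "0 < e" for e :: real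
  proof -
    obtain t \<tau> where 1: "t \<in> {0<..<1}" "\<tau> \<in> {0<..<1}"
      "f (x + e *\<^sub>R u + e *\<^sub>R v) - f (x + e *\<^sub>R u) - f (x + e *\<^sub>R v) + f x
        = hessian f (x + t *\<^sub>R (e *\<^sub>R u) + \<tau> *\<^sub>R (e *\<^sub>R v)) (e *\<^sub>R v) \<bullet> (e *\<^sub>R u)"
      using second_difference[OF C2, of x "e *\<^sub>R u" "e *\<^sub>R v"] by blast
    obtain t' \<tau>' where 2: "t' \<in> {0<..<1}" "\<tau>' \<in> {0<..<1}"
      "f (x + e *\<^sub>R v + e *\<^sub>R u) - f (x + e *\<^sub>R v) - f (x + e *\<^sub>R u) + f x
        = hessian f (x + t' *\<^sub>R (e *\<^sub>R v) + \<tau>' *\<^sub>R (e *\<^sub>R u)) (e *\<^sub>R u) \<bullet> (e *\<^sub>R v)"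
      using second_difference[OF C2, of x "e *\<^sub>R v" "e *\<^sub>R u"] by blast
    have near: "norm (x + a *\<^sub>R (e *\<^sub>R p) + b *\<^sub>R (e *\<^sub>R q) - x) \<le> e * (norm p + norm q)"
      if "a \<in> {0<..<1}" "b \<in> {0<..<1}" for a b and p q :: 'a
    proof -
      have "norm (a *\<^sub>R (e *\<^sub>R p) + b *\<^sub>R (e *\<^sub>R q)) \<le> a * (e * norm p) + b * (e * norm q)"
        using norm_triangle_ineq[of "a *\<^sub>R (e *\<^sub>R p)" "b *\<^sub>R (e *\<^sub>R q)"] that \<open>0 < e\<close> by simp
      also have "\<dots> \<le> 1 * (e * norm p) + 1 * (e * norm q)"
        using that \<open>0 < e\<close> by (intro add_mono mult_right_mono) auto
      finally show ?thesis
        by (simp add: algebra_simps)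
    qed
    \<comment> \<open>Both expressions equal the same second difference: interchanging
      \<open>u\<close> and \<open>v\<close> only reorders its terms.\<close>
    have "hessian f (x + t *\<^sub>R (e *\<^sub>R u) + \<tau> *\<^sub>R (e *\<^sub>R v)) (e *\<^sub>R v) \<bullet> (e *\<^sub>R u)
        = hessian f (x + t' *\<^sub>R (e *\<^sub>R v) + \<tau>' *\<^sub>R (e *\<^sub>R u)) (e *\<^sub>R u) \<bullet> (e *\<^sub>R v)"
      unfolding 1(3)[symmetric] 2(3)[symmetric] by (simp add: add_ac)
    then have "hessian f (x + t *\<^sub>R (e *\<^sub>R u) + \<tau> *\<^sub>R (e *\<^sub>R v)) v \<bullet> u
        = hessian f (x + t' *\<^sub>R (e *\<^sub>R v) + \<tau>' *\<^sub>R (e *\<^sub>R u)) u \<bullet> v"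
      using \<open>0 < e\<close> by (simp add: blinfun.scaleR_right del: scaleR_scaleR)
    then show ?thesis
      using near[OF 1(1,2)] near[OF 2(1,2), of v u] by (metis add.commute)
  qed
  then have "\<forall>n. \<exists>y z. norm (y - x) \<le> inverse (real (Suc n)) * (norm u + norm v) \<and>
      norm (z - x) \<le> inverse (real (Suc n)) * (norm u + norm v) \<and>
      hessian f y v \<bullet> u = hessian f z u \<bullet> v"
    by (simp del: of_nat_Suc)
  then obtain Y Z where YZ:
      "\<And>n. norm (Y n - x) \<le> inverse (real (Suc n)) * (norm u + norm v)"
      "\<And>n. norm (Z n - x) \<le> inverse (real (Suc n)) * (norm u + norm v)"
      "\<And>n. hessian f (Y n) v \<bullet> u = hessian f (Z n) u \<bullet> v"
    by metis
  have null: "(\<lambda>n. inverse (real (Suc n)) * (norm u + norm v)) \<longlonglongrightarrow> 0"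
    using tendsto_mult_right[OF LIMSEQ_inverse_real_of_nat] by fastforce
  have lim: "(\<lambda>n. hessian f (W n) p \<bullet> q) \<longlonglongrightarrow> hessian f x p \<bullet> q"
    if "\<And>n. norm (W n - x) \<le> inverse (real (Suc n)) * (norm u + norm v)" for W p q
  proof -
    have "(\<lambda>n. W n - x) \<longlonglongrightarrow> 0"
      using that by (intro Lim_null_comparison[OF _ null]) auto
    then have "W \<longlonglongrightarrow> x"
      by (simp add: LIM_zero_iff)
    then have "(\<lambda>n. hessian f (W n)) \<longlonglongrightarrow> hessian f x"
      by (rule isCont_tendsto_compose[OF twice_continuously_differentiableD(3)[OF C2]])
    then show ?thesis
      by (intro tendsto_intros)
  qed
  have "(\<lambda>n. hessian f (Y n) v \<bullet> u) \<longlonglongrightarrow> hessian f x u \<bullet> v"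
    unfolding YZ(3) by (rule lim) (rule YZ(2))
  then show ?thesis
    using lim[of Y v u] YZ(1) LIMSEQ_unique by blast
qed

section \<open>Taylor estimates for the function and its gradient\<close>

text \<open>By the Lagrange form of the remainder along the segment, the error is half the quadratic
  form of \<open>hessian f y - hessian f x\<close> at \<open>s\<close>, for one intermediate point
  \<open>y\<close>.\<close>

lemma quadratic_taylor_error:
  assumes C2: "twice_continuously_differentiable f"
    and close: "\<And>y. y \<in> closed_segment x (x + s) \<Longrightarrow> norm (hessian f y - hessian f x) \<le> \<epsilon>"
  shows "\<bar>f (x + s) - quadratic_model f x s\<bar> \<le> \<epsilon> / 2 * (norm s)\<^sup>2"
proof -
  let ?D = "\<lambda>(m::nat) t. if m = 0 then f (x + t *\<^sub>R s)
    else if m = 1 then gradient f (x + t *\<^sub>R s) \<bullet> s else hessian f (x + t *\<^sub>R s) s \<bullet> s"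
  have "\<forall>m t. m < 2 \<and> 0 \<le> t \<and> t \<le> 1 \<longrightarrow> DERIV (?D m) t :> ?D (Suc m) t"
    using DERIV_along_line[OF C2] DERIV_gradient_along_line[OF C2]
    by (auto simp: less_2_cases_iff)
  then obtain t where t: "0 < t" "t < 1"
    "f (x + 1 *\<^sub>R s) = (\<Sum>m<2. (?D m 0 / fact m) * (1 - 0)^m) + (?D 2 t / fact 2) * (1 - 0)^2"
    using Taylor_up[of 2 ?D "\<lambda>t. f (x + t *\<^sub>R s)" 0 1 0] by auto
  then have "f (x + s) - quadratic_model f x s
      = 1/2 * ((hessian f (x + t *\<^sub>R s) - hessian f x) s \<bullet> s)"
    by (simp add: quadratic_model_def numeral_2_eq_2 blinfun.diff_left inner_diff_left field_simps)
  moreover have "\<bar>(hessian f (x + t *\<^sub>R s) - hessian f x) s \<bullet> s\<bar> \<le> \<epsilon> * norm s * norm s"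
  proof -
    have "x + t *\<^sub>R s \<in> closed_segment x (x + s)"
      using t(1,2) by (auto simp: in_segment algebra_simps intro!: exI[of _ t])
    then have "norm ((hessian f (x + t *\<^sub>R s) - hessian f x) s) \<le> \<epsilon> * norm s"
      using close norm_blinfun[of "hessian f (x + t *\<^sub>R s) - hessian f x" s]
      by (meson mult_right_mono norm_ge_zero order_trans)
    then show ?thesis
      by (meson Cauchy_Schwarz_ineq2 mult_right_mono norm_ge_zero order_trans)
  qed
  ultimately show ?thesis
    unfolding power2_eq_square abs_le_iff by (simp add: field_simps)
qed

text \<open>The mean value inequality for the gradient minus its linear part at \<open>z\<close>.
  The reference point is left free because \<open>unicat_ratio_ge\<close> takes the start of the
  segment and \<open>newton_step_error\<close> its end.\<close>

lemma gradient_taylor_error: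
  assumes C2: "twice_continuously_differentiable f"
    and z: "z \<in> closed_segment x y"
    and close: "\<And>w. w \<in> closed_segment x y \<Longrightarrow> norm (hessian f w - hessian f z) \<le> \<epsilon>"
  shows "norm (gradient f y - gradient f x - hessian f z (y - x)) \<le> \<epsilon> * norm (y - x)"
proof -
  have "norm (gradient f y - gradient f x - hessian f z (y - x)) \<le> norm (y - x) * \<epsilon>"
  proof (rule differentiable_bound_linearization[where S = "closed_segment x y"
        and f' = "\<lambda>w. blinfun_apply (hessian f w)"])
    show "x + t *\<^sub>R (y - x) \<in> closed_segment x y" if "t \<in> {0..1}" for t
      using that by (auto simp: in_segment algebra_simps intro!: exI[of _ t])
    show "(gradient f has_derivative blinfun_apply (hessian f w)) (at w within closed_segment x y)" for w
      using twice_continuously_differentiableD(2)[OF C2] by (rule has_derivative_at_withinI)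
    show "onorm (blinfun_apply (hessian f w) - blinfun_apply (hessian f z)) \<le> \<epsilon>"
      if "w \<in> closed_segment x y" for w
      using close[OF that] by (simp add: norm_blinfun.rep_eq minus_blinfun.rep_eq fun_diff_def)
  qed (rule z)
  then show ?thesis
    by (simp add: mult.commute)
qed

section \<open>First-order condition and coercive operators\<close>

lemma gradient_zero_at_local_minimizer:
  assumes C2: "twice_continuously_differentiable f" and "local_minimizer f z"
  shows "gradient f z = 0"
proof -
  obtain e where e: "e > 0" "\<forall>y\<in>ball z e. f z \<le> f y"
    using assms(2) unfolding local_minimizer_def by blast
  have "(f has_derivative (\<lambda>h. h \<bullet> gradient f z)) (at z)"
    using twice_continuously_differentiableD(1)[OF C2] by (simp add: gderiv_def)
  then have "(\<lambda>h. h \<bullet> gradient f z) = (\<lambda>h. 0)"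
    by (rule differential_zero_maxmin[rotated 2, where S = "ball z e"]) (use e in auto)
  then show ?thesis
    by (metis inner_eq_zero_iff)
qed

text \<open>The quadratic form attains its minimum on the compact unit sphere; this positive value
  serves as \<mu>, and homogeneity of degree two extends the bound to all vectors.\<close>

lemma positive_definite_coercive:
  fixes A :: "'a::euclidean_space \<Rightarrow>\<^sub>L 'a"
  assumes "positive_definite A"
  shows "\<exists>\<mu>>0. \<forall>v. \<mu> * (norm v)\<^sup>2 \<le> A v \<bullet> v"
proof -
  have "\<exists>w\<in>sphere 0 1. \<forall>v\<in>sphere 0 1. A w \<bullet> w \<le> A v \<bullet> v"
    by (rule continuous_attains_inf) (auto intro!: continuous_intros)
  then obtain w where w: "norm w = 1" "\<And>v. norm v = 1 \<Longrightarrow> A w \<bullet> w \<le> A v \<bullet> v"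
    by auto
  then have "w \<noteq> 0"
    by auto
  then have "0 < A w \<bullet> w"
    using assms by (simp add: positive_definite_def)
  moreover have "A w \<bullet> w * (norm v)\<^sup>2 \<le> A v \<bullet> v" for v
  proof (cases "v = 0")
    case False
    then have "A w \<bullet> w \<le> A (v /\<^sub>R norm v) \<bullet> (v /\<^sub>R norm v)"
      by (intro w(2)) simp
    with False show ?thesis
      by (simp add: blinfun.scaleR_right power2_eq_square field_simps)
  qed (simp add: blinfun.zero_right)
  ultimately show ?thesis
    by blast
qed

lemma coercive_perturbation:
  fixes A B :: "'a::real_inner \<Rightarrow>\<^sub>L 'a"
  assumes "\<And>v. \<mu> * (norm v)\<^sup>2 \<le> A v \<bullet> v" and "norm (B - A) \<le> \<epsilon>"
  shows "(\<mu> - \<epsilon>) * (norm v)\<^sup>2 \<le> B v \<bullet> v"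
proof -
  have "norm ((B - A) v) \<le> \<epsilon> * norm v"
    using assms(2) norm_blinfun[of "B - A" v] by (meson mult_right_mono norm_ge_zero order_trans)
  then have "\<bar>(B - A) v \<bullet> v\<bar> \<le> \<epsilon> * norm v * norm v"
    by (meson Cauchy_Schwarz_ineq2 mult_right_mono norm_ge_zero order_trans)
  then show ?thesis
    using assms(1)[of v] by (simp add: blinfun.diff_left inner_diff_left algebra_simps power2_eq_square)
qed

lemma coercive_norm_bound:
  fixes A :: "'a::real_inner \<Rightarrow>\<^sub>L 'a"
  assumes "\<And>v. \<mu> * (norm v)\<^sup>2 \<le> A v \<bullet> v"
  shows "\<mu> * norm v \<le> norm (A v)"
proof (cases "v = 0")
  case False
  have "\<mu> * norm v * norm v \<le> norm (A v) * norm v"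
    using assms[of v] norm_cauchy_schwarz[of "A v" v] by (simp add: power2_eq_square)
  with False show ?thesis
    by simp
qed simp

text \<open>Coercivity makes the kernel trivial, and in finite dimension injectivity gives
  surjectivity.\<close>

lemma coercive_bij:
  fixes A :: "'a::euclidean_space \<Rightarrow>\<^sub>L 'a"
  assumes "0 < \<mu>" "\<And>v. \<mu> * (norm v)\<^sup>2 \<le> A v \<bullet> v"
  shows "bij (blinfun_apply A)"
proof -
  have lin: "linear (blinfun_apply A)"
    by (simp add: blinfun.bounded_linear_right bounded_linear.linear)
  have "v = 0" if "A v = 0" for v
    using coercive_norm_bound[OF assms(2), where v = v] that assms(1)
    by (simp add: mult_le_0_iff)
  then have "inj (blinfun_apply A)"
    using linear_injective_0[OF lin] by blast
  with lin show ?thesis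
    by (simp add: bij_def linear_injective_imp_surjective)
qed

section \<open>Minimizers of the trust-region subproblem\<close>

text \<open>\<open>G\<close> is the gradient of the model at \<open>s\<close> because the Hessian is symmetric.\<close>

lemma model_minimizer_variational:
  assumes C2: "twice_continuously_differentiable f"
    and min: "is_arg_min (quadratic_model f x) (\<lambda>u. norm u \<le> D) s"
    and u: "norm u \<le> D"
  defines "G \<equiv> gradient f x + hessian f x s"
  shows "0 \<le> G \<bullet> (u - s)"
proof (rule ccontr)
  assume "\<not> ?thesis"
  then have neg: "G \<bullet> (u - s) < 0"
    by simp
  have s: "norm s \<le> D" "\<And>v. norm v \<le> D \<Longrightarrow> quadratic_model f x s \<le> quadratic_model f x v"
    using min unfolding is_arg_min_linorder by auto
  define d where "d = u - s"
  \<comment> \<open>By convexity of the ball \<open>s + t *\<^sub>R d\<close> is feasible. The model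
    grows along it by \<open>t\<close> times the right side, so dividing by \<open>t\<close> and
    letting \<open>t\<close> tend to 0 contradicts \<open>neg\<close>.\<close>
  have ineq: "0 \<le> G \<bullet> d + t / 2 * (hessian f x d \<bullet> d)" if "0 < t" "t \<le> 1" for t
  proof -
    have "s + t *\<^sub>R d \<in> cball 0 D"
      using convexD_alt[OF convex_cball[of 0 D], of s u t] s(1) u that
      by (simp add: d_def algebra_simps)
    then have "quadratic_model f x s \<le> quadratic_model f x (s + t *\<^sub>R d)"
      by (intro s(2)) simp
    then have "0 \<le> t * (G \<bullet> d + t / 2 * (hessian f x d \<bullet> d))"
      using hessian_symmetric[OF C2, of x s d]
      by (simp add: quadratic_model_def G_def blinfun.add_right blinfun.scaleR_right
          inner_add_left inner_add_right algebra_simps)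
    with that show ?thesis
      by (simp add: zero_le_mult_iff)
  qed
  have "((\<lambda>t. G \<bullet> d + t / 2 * (hessian f x d \<bullet> d)) \<longlongrightarrow> G \<bullet> d + 0 / 2 * (hessian f x d \<bullet> d))
      (at_right (0::real))"
    by (intro tendsto_intros) simp
  moreover have "\<forall>\<^sub>F t in at_right (0::real). 0 \<le> G \<bullet> d + t / 2 * (hessian f x d \<bullet> d)"
    using eventually_at_right_real[OF zero_less_one] by (rule eventually_mono) (use ineq in simp)
  ultimately have "0 \<le> G \<bullet> d + 0 / 2 * (hessian f x d \<bullet> d)"
    by (rule tendsto_lowerbound) simp
  with neg show False
    by (simp add: d_def)
qed

text \<open>Testing the variational inequality with \<open>u = -D G / \<parallel>G\<parallel>\<close> replaces the Lagrange multiplier.\<close>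

lemma model_minimizer_gradient:
  assumes C2: "twice_continuously_differentiable f" and D: "0 < D"
    and min: "is_arg_min (quadratic_model f x) (\<lambda>u. norm u \<le> D) s"
  defines "G \<equiv> gradient f x + hessian f x s"
  shows "norm G * D \<le> - (G \<bullet> s)"
proof -
  \<comment> \<open>For \<open>G = 0\<close> the quotient \<open>D / norm G\<close> is 0 by
    convention, so the test point is the origin, which is feasible as well.\<close>
  have "0 \<le> G \<bullet> ((- (D / norm G)) *\<^sub>R G - s)"
    unfolding G_def using D by (intro model_minimizer_variational[OF C2 min]) simp
  then show ?thesis
    by (cases "G = 0") (simp_all add: inner_diff_right dot_square_norm power2_eq_square mult.commute)
qed

text \<open>A nonzero model gradient would give \<open>norm G * D \<le> norm G * norm s\<close> by
  \<open>model_minimizer_gradient\<close> and Cauchy-Schwarz, against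
  \<open>norm s < D\<close>.\<close>

lemma model_minimizer_interior:
  assumes C2: "twice_continuously_differentiable f"
    and min: "is_arg_min (quadratic_model f x) (\<lambda>u. norm u \<le> D) s"
    and int: "norm s < D"
  shows "gradient f x + hessian f x s = 0"
proof (rule ccontr)
  let ?G = "gradient f x + hessian f x s"
  assume "?G \<noteq> 0"
  then have "norm ?G * norm s < norm ?G * D"
    using int by simp
  also have "\<dots> \<le> - (?G \<bullet> s)"
    using int norm_ge_zero[of s] by (intro model_minimizer_gradient[OF C2 _ min]) linarith
  also have "\<dots> \<le> norm ?G * norm s"
    using Cauchy_Schwarz_ineq2[of ?G s] by linarith
  finally show False
    by simp
qed

text \<open>Comparison with the feasible zero step. The bound is independent of the radius, so steps
  vanish with the gradients before anything is known about the radii.\<close>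

lemma model_minimizer_norm_bound:
  assumes D: "0 < D"
    and min: "is_arg_min (quadratic_model f x) (\<lambda>u. norm u \<le> D) s"
    and coercive: "\<And>v. \<mu> * (norm v)\<^sup>2 \<le> hessian f x v \<bullet> v"
  shows "\<mu> * norm s \<le> 2 * norm (gradient f x)"
proof (cases "s = 0")
  case False
  have "quadratic_model f x s \<le> quadratic_model f x 0"
    using min D unfolding is_arg_min_linorder by simp
  then have "\<mu> * (norm s)\<^sup>2 \<le> - 2 * (gradient f x \<bullet> s)"
    using coercive[of s] by (simp add: quadratic_model_def blinfun.zero_right)
  also have "\<dots> \<le> 2 * (norm (gradient f x) * norm s)"
    using Cauchy_Schwarz_ineq2[of "gradient f x" s] by linarith
  finally show ?thesis
    using False by (simp add: power2_eq_square)
qed simp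

section \<open>Ratio and error of a single iteration\<close>

text \<open>Relative to the predicted decrease, the numerator is at least
  \<open>1 - \<epsilon> / \<mu>\<close> and the denominator at most
  \<open>1 + \<theta> / 2 + \<theta> * \<epsilon> / \<mu>\<close>; the last hypothesis compares the
  two with denominators cleared.\<close>

lemma unicat_ratio_ge:
  assumes C2: "twice_continuously_differentiable f" and D: "0 < D"
    and min: "is_arg_min (quadratic_model f x) (\<lambda>u. norm u \<le> D) s"
    and g: "gradient f x \<noteq> 0"
    and coercive: "0 < \<mu>" "\<And>v. \<mu> * (norm v)\<^sup>2 \<le> hessian f x v \<bullet> v"
    and close: "\<And>y. y \<in> closed_segment x (x + s) \<Longrightarrow> norm (hessian f y - hessian f x) \<le> \<epsilon>"
    and \<theta>: "0 < \<theta>" and \<eta>: "0 \<le> \<eta>" "\<eta> * (1 + \<theta> / 2 + \<theta> * \<epsilon> / \<mu>) \<le> 1 - \<epsilon> / \<mu>"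
  shows "\<eta> \<le> unicat_ratio f \<theta> x s"
proof -
  define G where "G = gradient f x + hessian f x s"
  define pred where "pred = quadratic_model f x 0 - quadratic_model f x s"
  have \<epsilon>: "0 \<le> \<epsilon>"
    using close[of x] by simp
  have GD: "norm G * D \<le> - (G \<bullet> s)"
    unfolding G_def by (rule model_minimizer_gradient[OF C2 D min])
  have s: "norm s \<le> D"
    using min unfolding is_arg_min_linorder by simp
  \<comment> \<open>At \<open>s = 0\<close> the inequality \<open>GD\<close> would read
    \<open>norm (gradient f x) * D \<le> 0\<close>.\<close>
  have s0: "s \<noteq> 0"
    using GD D g by (auto simp: G_def blinfun.zero_right mult_le_0_iff)
  \<comment> \<open>Expressed through the model gradient at \<open>s\<close>, the decrease is a sum
    of two nonnegative terms; dropping the first yields \<open>pred_ge\<close>, dropping the second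
    \<open>Gs_le\<close>.\<close>
  have pred_eq: "pred = - (G \<bullet> s) + 1/2 * (hessian f x s \<bullet> s)"
    by (simp add: pred_def quadratic_model_def G_def inner_add_left blinfun.zero_right)
  have "norm G * norm s \<le> norm G * D"
    using s by (simp add: mult_left_mono)
  with GD have Gs: "norm G * norm s \<le> - (G \<bullet> s)"
    by linarith
  have nonneg: "0 \<le> norm G * norm s" "0 \<le> \<mu> * (norm s)\<^sup>2"
    using coercive(1) by simp_all
  have pred_ge: "\<mu> / 2 * (norm s)\<^sup>2 \<le> pred"
    using Gs pred_eq coercive(2)[of s] nonneg(1) by linarith
  have Gs_le: "norm G * norm s \<le> pred"
    using Gs pred_eq coercive(2)[of s] nonneg(2) by linarith
  have pred_pos: "0 < pred"
    using pred_ge coercive(1) s0 by (smt (verit) half_gt_zero mult_pos_pos zero_less_norm_iff zero_less_power)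
  have ssq: "(norm s)\<^sup>2 \<le> 2 / \<mu> * pred"
    using pred_ge coercive(1) by (simp add: field_simps)
  have num: "(1 - \<epsilon> / \<mu>) * pred \<le> f x - f (x + s)"
  proof -
    have "pred - \<epsilon> / 2 * (norm s)\<^sup>2 \<le> f x - f (x + s)"
      using quadratic_taylor_error[where s = s, OF C2 close]
      by (simp add: pred_def quadratic_model_def blinfun.zero_right abs_le_iff field_simps)
    moreover have "\<epsilon> / 2 * (norm s)\<^sup>2 \<le> \<epsilon> / 2 * (2 / \<mu> * pred)"
      using \<epsilon> ssq by (intro mult_left_mono) auto
    ultimately show ?thesis
      by (simp add: left_diff_distrib)
  qed
  define q where "q = min (norm (gradient f x)) (norm (gradient f (x + s))) * norm s"
  \<comment> \<open>The minimum is bounded by the gradient norm at the trial point. The leading 1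
    comes from \<open>Gs_le\<close> and is the source of the threshold
    \<open>1 / (1 + \<theta> / 2)\<close> for \<eta>2.\<close>
  have q: "q \<le> (1 + 2 * \<epsilon> / \<mu>) * pred"
  proof -
    have "norm (gradient f (x + s) - gradient f x - hessian f x s) \<le> \<epsilon> * norm s"
      using gradient_taylor_error[OF C2, of x x "x + s" \<epsilon>] close by simp
    then have "norm (gradient f (x + s)) \<le> norm G + \<epsilon> * norm s"
      using norm_triangle_ineq[of G "gradient f (x + s) - gradient f x - hessian f x s"]
      by (simp add: G_def algebra_simps)
    then have "q \<le> (norm G + \<epsilon> * norm s) * norm s"
      unfolding q_def by (intro mult_right_mono) auto
    also have "\<dots> \<le> pred + \<epsilon> * (norm s)\<^sup>2"
      using Gs_le by (simp add: algebra_simps power2_eq_square)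
    also have "\<dots> \<le> pred + \<epsilon> * (2 / \<mu> * pred)"
      using \<epsilon> ssq by (intro add_left_mono mult_left_mono)
    finally show ?thesis
      by (simp add: algebra_simps)
  qed
  have q0: "0 \<le> q"
    by (simp add: q_def)
  have "\<eta> * (pred + \<theta> / 2 * q) \<le> \<eta> * (pred + \<theta> / 2 * ((1 + 2 * \<epsilon> / \<mu>) * pred))"
    using \<eta>(1) \<theta> q by (intro mult_left_mono add_left_mono) auto
  also have "\<dots> = \<eta> * (1 + \<theta> / 2 + \<theta> * \<epsilon> / \<mu>) * pred"
    by (simp add: field_simps)
  also have "\<dots> \<le> (1 - \<epsilon> / \<mu>) * pred"
    using \<eta>(2) pred_pos by (intro mult_right_mono) auto
  also note num
  finally have "\<eta> * (pred + \<theta> / 2 * q) \<le> f x - f (x + s)" .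
  moreover have "0 < pred + \<theta> / 2 * q"
    using pred_pos q0 \<theta> by (simp add: add_pos_nonneg)
  ultimately show ?thesis
    by (simp add: unicat_ratio_def pred_def[symmetric] q_def mult.assoc pos_le_divide_eq)
qed

text \<open>By the Newton equation, the Hessian at \<open>x\<close> maps the new error to minus the
  linearization error of the gradient between \<open>z\<close> and \<open>x\<close>; coercivity
  turns this into a bound on the new error.\<close>

lemma newton_step_error:
  assumes C2: "twice_continuously_differentiable f"
    and crit: "gradient f z = 0"
    and newton: "gradient f x + hessian f x s = 0"
    and coercive: "\<And>v. \<mu> * (norm v)\<^sup>2 \<le> hessian f x v \<bullet> v"
    and close: "\<And>y. y \<in> closed_segment z x \<Longrightarrow> norm (hessian f y - hessian f x) \<le> \<epsilon>"
  shows "\<mu> * norm (x + s - z) \<le> \<epsilon> * norm (x - z)"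
proof -
  have "hessian f x (x + s - z) = - (gradient f x - gradient f z - hessian f x (x - z))"
    using newton crit by (simp add: blinfun.add_right blinfun.diff_right algebra_simps add_eq_0_iff)
  then have "norm (hessian f x (x + s - z)) \<le> \<epsilon> * norm (x - z)"
    using gradient_taylor_error[OF C2, of x z x \<epsilon>] close by (simp only: norm_minus_cancel) simp
  with coercive_norm_bound[OF coercive, where v = "x + s - z"] show ?thesis
    by linarith
qed

theorem theorem21:
  fixes f :: "'a::euclidean_space \<Rightarrow> real"
    and x s :: "nat \<Rightarrow> 'a" and \<Delta> :: "nat \<Rightarrow> real"
    and xstar :: 'a
    and L \<nu> \<theta> \<eta>1 \<eta>2 \<gamma>1 \<gamma>2 \<gamma>3 :: real
  assumes C2: "twice_continuously_differentiable f"
    and bounded_below: "bdd_below (range f)"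
    and minimizers: "{z. \<forall>y. f z \<le> f y} \<noteq> {}"
    and L: "0 < L" and nu: "0 \<le> \<nu>" "\<nu> \<le> 1"
    and hoelder: "\<And>y z. norm (hessian f y - hessian f z) \<le> L * norm (y - z) powr \<nu>"
    and theta: "0 < \<theta>"
    and eta: "0 < \<eta>1" "\<eta>1 \<le> \<eta>2" "\<eta>2 < 1"
    and gamma: "0 < \<gamma>1" "\<gamma>1 \<le> \<gamma>2" "\<gamma>2 < 1" "1 \<le> \<gamma>3"
    and run: "unicat_run f \<theta> \<eta>1 \<eta>2 \<gamma>1 \<gamma>2 \<gamma>3 x \<Delta> s"
    and gradient_pos: "\<And>k. 0 < norm (gradient f (x k))"
    and gap_pos: "\<And>k. 0 < f (x k) - (INF z. f z)"
    and local_min: "local_minimizer f xstar"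
    and pos_def: "positive_definite (hessian f xstar)"
    and conv: "x \<longlonglongrightarrow> xstar"
    and eta2: "\<eta>2 < 1 / (1 + \<theta> / 2)"
  shows "\<exists>K0 \<Delta>min. 0 < \<Delta>min \<and>
    (\<forall>k\<ge>K0. \<eta>2 \<le> unicat_ratio f \<theta> (x k) (s k)) \<and>
    (\<forall>k\<ge>K0. \<Delta>min \<le> \<Delta> k) \<and>
    (\<forall>k\<ge>K0. norm (s k) < \<Delta> k \<and>
       bij (blinfun_apply (hessian f (x k))) \<and>
       s k = - inv (blinfun_apply (hessian f (x k))) (gradient f (x k))) \<and>
    (\<nu> = 0 \<longrightarrow> (\<lambda>k. norm (x (Suc k) - xstar)) \<in> o(\<lambda>k. norm (x k - xstar))) \<and>
    (0 < \<nu> \<and> \<nu> \<le> 1 \<longrightarrow>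
       (\<exists>C>0. \<forall>\<^sub>F k in sequentially.
          norm (x (Suc k) - xstar) \<le> C * norm (x k - xstar) powr (1 + \<nu>)))"
proof -

  \<comment> \<open>Consequences of the iteration rule\<close>
  have iteration: "unicat_step f \<theta> \<eta>1 \<eta>2 \<gamma>1 \<gamma>2 \<gamma>3 (x k) (\<Delta> k) (s k) (x (Suc k)) (\<Delta> (Suc k))" for k
    using run by (simp add: unicat_run_def)
  have \<Delta>_pos: "0 < \<Delta> k" for k
  proof (induction k)
    case 0
    then show ?case
      using run by (simp add: unicat_run_def)
  next
    case (Suc k)
    moreover have "0 < \<gamma>1 * \<Delta> k" "0 < \<gamma>2 * \<Delta> k"
      using Suc gamma by auto
    ultimately show ?case
      using iteration[of k] unfolding unicat_step_def by (auto split: if_splits)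
  qed
  have step: "is_arg_min (quadratic_model f (x k)) (\<lambda>u. norm u \<le> \<Delta> k) (s k)" for k
    using iteration[of k] by (simp add: unicat_step_def)
  have very_successful: "x (Suc k) = x k + s k \<and> \<Delta> k \<le> \<Delta> (Suc k)"
    if "\<eta>2 \<le> unicat_ratio f \<theta> (x k) (s k)" for k
    using iteration[of k] that eta(2) by (simp add: unicat_step_def)
  have crit: "gradient f xstar = 0"
    by (rule gradient_zero_at_local_minimizer[OF C2 local_min])

  \<comment> \<open>Constants and neighbourhoods of the limit\<close>
  obtain \<mu>0 where \<mu>0: "0 < \<mu>0" "\<And>v. \<mu>0 * (norm v)\<^sup>2 \<le> hessian f xstar v \<bullet> v"
    using positive_definite_coercive[OF pos_def] by blast
  \<comment> \<open>Half of the coercivity at \<open>xstar\<close> is kept in reserve: Hessians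
    within \<mu> of the limit are coercive with constant
    \<open>\<mu>0 - \<mu> = \<mu>\<close>.\<close>
  define \<mu> where "\<mu> = \<mu>0 / 2"
  \<comment> \<open>The ratio estimate will be applied with \<open>\<epsilon> = \<mu> \<delta>\<close>, for which \<open>\<delta>\<close> is chosen to make its
    hypothesis \<open>ratio_cond\<close> hold.\<close>
  define \<delta> where "\<delta> = (1 - \<eta>2 * (1 + \<theta> / 2)) / (1 + \<theta>)"
  have \<mu>: "0 < \<mu>"
    using \<mu>0 by (simp add: \<mu>_def)
  \<comment> \<open>The assumed bound on \<eta>2 enters here and makes \<delta> positive.\<close>
  have "\<eta>2 * (1 + \<theta> / 2) < 1"
    using eta2 theta by (simp add: field_simps)
  then have \<delta>: "0 < \<delta>"
    using theta by (simp add: \<delta>_def)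
  have "\<delta> * (1 + \<theta>) = 1 - \<eta>2 * (1 + \<theta> / 2)"
    using theta by (simp add: \<delta>_def)
  then have \<delta>_eq: "\<delta> + \<theta> * \<delta> = 1 - \<eta>2 * (1 + \<theta> / 2)"
    by (simp add: algebra_simps)
  \<comment> \<open>Replacing \<eta>2 by 1 in this term makes the required condition linear in
    \<delta>, and \<open>\<delta>_eq\<close> satisfies it with equality.\<close>
  have "\<eta>2 * (\<theta> * \<delta>) \<le> 1 * (\<theta> * \<delta>)"
    using eta theta \<delta> by (intro mult_right_mono) auto
  with \<delta>_eq have ratio_cond: "\<eta>2 * (1 + \<theta> / 2 + \<theta> * (\<mu> * \<delta>) / \<mu>) \<le> 1 - (\<mu> * \<delta>) / \<mu>"
    using \<mu> by (simp add: algebra_simps)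

  have hessian_near: "\<exists>d>0. \<forall>y\<in>ball xstar d. norm (hessian f y - hessian f xstar) < e" if "0 < e" for e
    using twice_continuously_differentiableD(3)[OF C2, of xstar] that
    by (simp add: continuous_at_eps_delta dist_norm norm_minus_commute[of xstar] Ball_def)
  have near: "\<forall>\<^sub>F k in sequentially. X k \<in> ball xstar d" if "X \<longlonglongrightarrow> xstar" "0 < d" for X d
    using tendstoD[OF that] by eventually_elim (simp add: dist_commute)
  \<comment> \<open>The ball contains the segment by convexity, and the triangle inequality passes
    through the Hessian at \<open>xstar\<close>. The factor 2 explains the halves in later choices
    of radii.\<close>
  have hessian_segment: "norm (hessian f y - hessian f a) \<le> 2 * e"
    if "\<forall>y\<in>ball xstar d. norm (hessian f y - hessian f xstar) < e"
      "a \<in> ball xstar d" "b \<in> ball xstar d" "y \<in> closed_segment a b" for a b y d e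
  proof -
    have "y \<in> ball xstar d"
      using that closed_segment_subset[OF that(2,3) convex_ball] by blast
    then have "norm (hessian f y - hessian f xstar) < e" "norm (hessian f a - hessian f xstar) < e"
      using that by auto
    then show ?thesis
      using norm_triangle_ineq4[of "hessian f y - hessian f xstar" "hessian f a - hessian f xstar"]
      by simp
  qed

  \<comment> \<open>Coercivity along the run and vanishing steps\<close>
  obtain d0 where d0: "0 < d0" "\<forall>y\<in>ball xstar d0. norm (hessian f y - hessian f xstar) < \<mu>"
    using hessian_near[OF \<mu>] by blast
  have coercive: "\<forall>\<^sub>F k in sequentially. \<forall>v. \<mu> * (norm v)\<^sup>2 \<le> hessian f (x k) v \<bullet> v"
    using near[OF conv d0(1)]
  proof eventually_elim
    case (elim k)
    then have "norm (hessian f (x k) - hessian f xstar) \<le> \<mu>"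
      using d0(2) by (simp add: less_imp_le)
    from coercive_perturbation[OF \<mu>0(2) this] show ?case
      by (simp add: \<mu>_def)
  qed

  have "isCont (gradient f) xstar"
    using twice_continuously_differentiableD(2)[OF C2] by (rule has_derivative_continuous)
  then have "(\<lambda>k. gradient f (x k)) \<longlonglongrightarrow> 0"
    using isCont_tendsto_compose[OF _ conv] crit by metis
  then have "(\<lambda>k. 2 / \<mu> * norm (gradient f (x k))) \<longlonglongrightarrow> 0"
    by (intro tendsto_mult_right_zero tendsto_norm_zero)
  moreover have "\<forall>\<^sub>F k in sequentially. norm (s k) \<le> 2 / \<mu> * norm (gradient f (x k))"
    using coercive
  proof eventually_elim
    case (elim k)
    then have "\<mu> * norm (s k) \<le> 2 * norm (gradient f (x k))"
      by (intro model_minimizer_norm_bound[OF \<Delta>_pos step]) blast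
    with \<mu> show ?case
      by (simp add: field_simps)
  qed
  ultimately have s_null: "s \<longlonglongrightarrow> 0"
    by (rule Lim_null_comparison[rotated])
  then have trial: "(\<lambda>k. x k + s k) \<longlonglongrightarrow> xstar"
    using tendsto_add[OF conv s_null] by simp

  \<comment> \<open>Very successful steps and a lower bound for the radii\<close>
  have "0 < \<mu> * \<delta> / 2"
    using \<mu> \<delta> by simp
  then obtain d1 where d1: "0 < d1" "\<forall>y\<in>ball xstar d1. norm (hessian f y - hessian f xstar) < \<mu> * \<delta> / 2"
    using hessian_near by blast
  have "\<forall>\<^sub>F k in sequentially. \<eta>2 \<le> unicat_ratio f \<theta> (x k) (s k)"
    using coercive near[OF conv d1(1)] near[OF trial d1(1)]
  proof eventually_elim
    case (elim k)
    have "norm (hessian f y - hessian f (x k)) \<le> \<mu> * \<delta>"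
      if "y \<in> closed_segment (x k) (x k + s k)" for y
      using hessian_segment[OF d1(2) elim(2,3) that] by simp
    moreover have "gradient f (x k) \<noteq> 0"
      using gradient_pos[of k] by auto
    ultimately show ?case
      using elim(1) eta
      by (intro unicat_ratio_ge[OF C2 \<Delta>_pos step _ \<mu> _ _ theta _ ratio_cond]) auto
  qed
  then obtain K1 where K1: "\<And>k. k \<ge> K1 \<Longrightarrow> \<eta>2 \<le> unicat_ratio f \<theta> (x k) (s k)"
    unfolding eventually_sequentially by blast
  \<comment> \<open>From \<open>K1\<close> on no update shrinks the radius, so
    \<open>\<Delta> K1\<close> is the lower bound sought.\<close>
  have radius: "\<Delta> K1 \<le> \<Delta> k" if "k \<ge> K1" for k
    using that by (induction k rule: dec_induct) (use very_successful K1 in \<open>auto intro: order_trans\<close>)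

  \<comment> \<open>Inactive constraint and Newton steps\<close>
  have "\<forall>\<^sub>F k in sequentially. norm (s k) < \<Delta> K1"
    using order_tendstoD(2)[OF tendsto_norm_zero[OF s_null] \<Delta>_pos] .
  then have "\<forall>\<^sub>F k in sequentially. k \<ge> K1 \<and> norm (s k) < \<Delta> K1 \<and>
      (\<forall>v. \<mu> * (norm v)\<^sup>2 \<le> hessian f (x k) v \<bullet> v)"
    using coercive eventually_ge_at_top[of K1] by eventually_elim blast
  then obtain K0 where K0: "\<And>k. k \<ge> K0 \<Longrightarrow> k \<ge> K1 \<and> norm (s k) < \<Delta> K1 \<and>
      (\<forall>v. \<mu> * (norm v)\<^sup>2 \<le> hessian f (x k) v \<bullet> v)"
    unfolding eventually_sequentially by blast

  have interior: "norm (s k) < \<Delta> k" if "k \<ge> K0" for k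
    using K0[OF that] radius[of k] by auto
  have newton: "gradient f (x k) + hessian f (x k) (s k) = 0" if "k \<ge> K0" for k
    using model_minimizer_interior[OF C2 step interior[OF that]] .
  have bij: "bij (blinfun_apply (hessian f (x k)))" if "k \<ge> K0" for k
    using K0[OF that] by (intro coercive_bij[OF \<mu>]) blast
  have newton_inv: "s k = - inv (blinfun_apply (hessian f (x k))) (gradient f (x k))" if "k \<ge> K0" for k
  proof -
    have "gradient f (x k) = hessian f (x k) (- s k)"
      using newton[OF that] by (simp add: blinfun.minus_right add_eq_0_iff2)
    then show ?thesis
      using bij[OF that] by (simp add: bij_is_inj)
  qed
  \<comment> \<open>Both rates follow from this estimate and differ only in the choice of
    \<epsilon>.\<close>
  have error: "\<mu> * norm (x (Suc k) - xstar) \<le> \<epsilon> * norm (x k - xstar)"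
    if "k \<ge> K0" "\<And>y. y \<in> closed_segment xstar (x k) \<Longrightarrow> norm (hessian f y - hessian f (x k)) \<le> \<epsilon>"
    for k \<epsilon>
  proof -
    have "x (Suc k) = x k + s k"
      using very_successful K1 K0[OF that(1)] by blast
    then show ?thesis
      using newton_step_error[OF C2 crit newton[OF that(1)] _ that(2)] K0[OF that(1)] by auto
  qed

  \<comment> \<open>Rates of convergence\<close>
  have superlinear: "(\<lambda>k. norm (x (Suc k) - xstar)) \<in> o(\<lambda>k. norm (x k - xstar))"
  proof (rule landau_o.smallI)
    fix c :: real
    assume "0 < c"
    then have "0 < \<mu> * c / 2"
      using \<mu> by simp
    \<comment> \<open>Continuity of the Hessian supplies \<open>\<epsilon> = \<mu> * c\<close>
      through \<open>hessian_segment\<close>; dividing \<open>error\<close> by \<mu> leaves the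
      prescribed factor \<open>c\<close>.\<close>
    then obtain d where d: "0 < d" "\<forall>y\<in>ball xstar d. norm (hessian f y - hessian f xstar) < \<mu> * c / 2"
      using hessian_near by blast
    show "\<forall>\<^sub>F k in sequentially. norm (norm (x (Suc k) - xstar)) \<le> c * norm (norm (x k - xstar))"
      using near[OF conv d(1)] eventually_ge_at_top[of K0]
    proof eventually_elim
      case (elim k)
      have "\<mu> * norm (x (Suc k) - xstar) \<le> (\<mu> * c) * norm (x k - xstar)"
      proof (rule error[OF elim(2)])
        fix y
        assume "y \<in> closed_segment xstar (x k)"
        then show "norm (hessian f y - hessian f (x k)) \<le> \<mu> * c"
          using hessian_segment[OF d(2) elim(1), of xstar y] d(1)
          by (simp add: closed_segment_commute)
      qed
      with \<mu> show ?case
        by simp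
    qed
  qed

  have order: "\<forall>\<^sub>F k in sequentially.
      norm (x (Suc k) - xstar) \<le> L / \<mu> * norm (x k - xstar) powr (1 + \<nu>)"
    using eventually_ge_at_top[of K0]
  proof eventually_elim
    case (elim k)
    \<comment> \<open>Points of the segment are no farther from \<open>x k\<close> than
      \<open>xstar\<close> is, so the Hoelder condition gives \<epsilon> as \<open>L\<close> times
      the \<nu>-th power of the current error, hence the constant \<open>L / \<mu>\<close>.\<close>
    have "\<mu> * norm (x (Suc k) - xstar) \<le> (L * norm (x k - xstar) powr \<nu>) * norm (x k - xstar)"
    proof (rule error[OF elim])
      fix y
      assume "y \<in> closed_segment xstar (x k)"
      then have "norm (y - x k) \<le> norm (x k - xstar)"
        using segment_bound[of y xstar "x k"] by (simp add: norm_minus_commute)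
      then have "L * norm (y - x k) powr \<nu> \<le> L * norm (x k - xstar) powr \<nu>"
        using L nu by (intro mult_left_mono powr_mono2) auto
      with hoelder[of y "x k"] show "norm (hessian f y - hessian f (x k)) \<le> L * norm (x k - xstar) powr \<nu>"
        by linarith
    qed
    also have "\<dots> = L * norm (x k - xstar) powr (1 + \<nu>)"
      by (simp add: powr_add)
    finally show ?case
      using \<mu> by (simp add: field_simps)
  qed

  show ?thesis
  proof (rule exI[of _ K0], rule exI[of _ "\<Delta> K1"], intro conjI impI allI)
    show "\<exists>C>0. \<forall>\<^sub>F k in sequentially.
        norm (x (Suc k) - xstar) \<le> C * norm (x k - xstar) powr (1 + \<nu>)"
      using order L \<mu> by (intro exI[of _ "L / \<mu>"]) auto
    show "0 < \<Delta> K1"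
      by (rule \<Delta>_pos)
  next
    fix k
    assume k: "K0 \<le> k"
    show "\<eta>2 \<le> unicat_ratio f \<theta> (x k) (s k)" "\<Delta> K1 \<le> \<Delta> k"
      using K0[OF k] K1 radius by blast+
    show "norm (s k) < \<Delta> k" "bij (blinfun_apply (hessian f (x k)))"
      "s k = - inv (blinfun_apply (hessian f (x k))) (gradient f (x k))"
      using k by (rule interior bij newton_inv)+
  qed (rule superlinear)
qed

end
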